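(* Let $R$ be a commutative ring and let $\{N_1, N_2, \ldots, N_k\}$ be a collection of ideals of $R$ satisfying the CNC-condition. For $i=1,\dots,k-1$ let $s_i$ be the characteristic of the ideal $N_i$ in the ideal $N_{i+1}$. If $f\in R$ is such that $f+N_1$ is an idempotent element of the ring $R/N_1$, then $$f^{s_1s_2\cdots s_{k-1}}$$ is an idempotent element of the ring $R$. Furthermore, $|E(R)|=|E(R/N_{k-1})|=\cdots=|E(R/N_{1})|$.
   Context: Rings have an identity. For a commutative ring $A$, $E(A)=\{e\in A : e^2=e\}$ denotes its set of idempotent elements, and $|X|$ denotes the cardinality of a set $X$. For an ideal $N$ and an integer $t>1$, $N^t$ is the ideal generated by all products $x_1x_2\cdots x_t$ with $x_1,\dots,x_t\in N$. The symbol $\subset$ denotes (not necessarily strict) inclusion. A collection $\{N_1,\dots,N_k\}$ of ideals of a commutative ring $R$ satisfies the CNC-condition if: (1) Chain condition: $\{0\}=N_k\subset N_{k-1}\subset\cdots\subset N_2\subset N_1\subset R$. (2) Nilpotency condition: for each $i=1,\dots,k-1$ there exists an integer $t_i\ge 2$ such that $N_i^{t_i}\subset N_{i+1}$. The minimum such $t_i$ is called the nilpotency index of $N_i$ in $N_{i+1}$. (3) Characteristic condition: for each $i=1,\dots,k-1$ there exists an integer $s_i\ge 1$ such that $s_iN_i\subset N_{i+1}$; in addition, all prime factors of $s_i$ are greater than or equal to $t_i$. The minimum such $s_i$ is called the characteristic of $N_i$ in $N_{i+1}$. In (3), $t_i$ is the nilpotency index from (2). *)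

theory Defs
  imports "HOL-Algebra.QuotRing" "HOL-Library.Equipollence" "HOL-Computational_Algebra.Primes"
begin

definition idempotents :: "('a, 'b) ring_scheme \<Rightarrow> 'a set" where
  "idempotents A = {e \<in> carrier A. e [^]\<^bsub>A\<^esub> (2::nat) = e}"

definition ideal_pow :: "('a, 'b) ring_scheme \<Rightarrow> 'a set \<Rightarrow> nat \<Rightarrow> 'a set" where
  "ideal_pow R I t = genideal R {finprod R x {1..t} | x. x \<in> {1..t} \<rightarrow> I}"

definition nilpotent_in :: "('a, 'b) ring_scheme \<Rightarrow> 'a set \<Rightarrow> 'a set \<Rightarrow> nat \<Rightarrow> bool" where
  "nilpotent_in R I J t \<longleftrightarrow> t \<ge> 2 \<and> ideal_pow R I t \<subseteq> J"

text \<open>As a \<open>LEAST\<close>, this is only meaningful when some exponent satisfies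
  \<^const>\<open>nilpotent_in\<close>; likewise for \<open>ideal_characteristic\<close> below.\<close>

definition nilpotency_index :: "('a, 'b) ring_scheme \<Rightarrow> 'a set \<Rightarrow> 'a set \<Rightarrow> nat" where
  "nilpotency_index R I J = (LEAST t. nilpotent_in R I J t)"

definition characteristic_in :: "('a, 'b) ring_scheme \<Rightarrow> 'a set \<Rightarrow> 'a set \<Rightarrow> nat \<Rightarrow> bool" where
  "characteristic_in R I J s \<longleftrightarrow>
     s \<ge> 1 \<and> (\<forall>x\<in>I. [s] \<cdot>\<^bsub>R\<^esub> x \<in> J) \<and>
     (\<forall>p. prime p \<longrightarrow> p dvd s \<longrightarrow> nilpotency_index R I J \<le> p)"

text \<open>Minimising only over \<open>s \<ge> 1\<close> with \<open>s I \<subseteq> J\<close> would give the same number whenever an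
  admissible \<open>s\<close> exists: that minimum divides every such \<open>s\<close> and so inherits the
  condition on prime factors.\<close>

definition ideal_characteristic :: "('a, 'b) ring_scheme \<Rightarrow> 'a set \<Rightarrow> 'a set \<Rightarrow> nat" where
  "ideal_characteristic R I J = (LEAST s. characteristic_in R I J s)"

text \<open>Only the values \<open>N 1, \<dots>, N k\<close> of the family are relevant.\<close>

definition CNC :: "('a, 'b) ring_scheme \<Rightarrow> nat \<Rightarrow> (nat \<Rightarrow> 'a set) \<Rightarrow> bool" where
  "CNC R k N \<longleftrightarrow>
     k \<ge> 1 \<and> (\<forall>i\<in>{1..k}. ideal (N i) R) \<and>
     N k = {\<zero>\<^bsub>R\<^esub>} \<and> (\<forall>i\<in>{1..<k}. N (Suc i) \<subseteq> N i) \<and>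
     (\<forall>i\<in>{1..<k}. \<exists>t. nilpotent_in R (N i) (N (Suc i)) t) \<and>
     (\<forall>i\<in>{1..<k}. \<exists>s. characteristic_in R (N i) (N (Suc i)) s)"

end

theory Submission
  imports Defs "HOL-Algebra.Multiplicative_Group"
begin

text \<open>
  The heart of the matter is a single link \<open>J \<subseteq> I\<close> of the chain. Suppose \<open>I\<^sup>t \<subseteq> J\<close>, \<open>s I \<subseteq> J\<close> and
  no prime factor of \<open>s\<close> is smaller than \<open>t\<close>. If \<open>f\<close> is idempotent modulo \<open>I\<close>, write
  \<open>f\<^sup>2 = f + d\<close> with \<open>d \<in> I\<close> and expand
  \<open>f\<^bsup>2s\<^esup> = (f + d)\<^sup>s = f\<^sup>s + (\<Sum>j = 1..s. (s choose j) f\<^bsup>s-j\<^esup> d\<^sup>j)\<close>. For \<open>j \<ge> t\<close> the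
  power \<open>d\<^sup>j\<close> lies in \<open>J\<close>. For \<open>0 < j < t\<close> the number \<open>j\<close> is coprime to \<open>s\<close>, so
  \<open>j (s choose j) = s (s-1 choose j-1)\<close> shows that \<open>s\<close> divides the binomial coefficient,
  and the term lies in \<open>s I \<subseteq> J\<close>. Hence \<open>f\<^sup>s\<close> is idempotent modulo \<open>J\<close>
  (\<open>idempotent_mod_ideal_pow\<close>). Descending the chain to \<open>N\<^sub>k = 0\<close> gives the first claim, and
  starting the descent at \<open>N\<^sub>i\<close> shows that every idempotent of \<open>R/N\<^sub>i\<close> lifts: the
  power of a representative that it produces is idempotent in \<open>R\<close> and represents the same
  class, since an idempotent class equals all its positive powers.

  The lift is unique. The difference \<open>d\<close> of two idempotents satisfies \<open>d\<^sup>3 = d\<close>, hence equals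
  all its odd powers; so if \<open>d\<close> lies in \<open>N\<^sub>i\<close> then a high odd power of it, which is \<open>d\<close>
  itself, lies in \<open>N\<^bsub>i+1\<^esub>\<close>, and so on down to \<open>0\<close>. Thus \<open>e \<mapsto> N\<^sub>i + e\<close> is a bijection between
  the idempotents of \<open>R\<close> and those of \<open>R/N\<^sub>i\<close>.
\<close>

section \<open>Binomial expansions in commutative rings\<close>

lemma dvd_binomial_if_coprime:
  fixes s j :: nat
  assumes "coprime s j" "0 < j"
  shows "s dvd (s choose j)"
proof -
  have "j * (s choose j) = s * ((s - 1) choose (j - 1))"
    using assms(2) by (rule times_binomial_minus1_eq)
  hence "s dvd j * (s choose j)" by simp
  thus ?thesis using assms(1) by (simp add: coprime_dvd_mult_right_iff)
qed

lemma coprime_if_prime_factors_ge: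
  fixes s t j :: nat
  assumes "\<And>p. prime p \<Longrightarrow> p dvd s \<Longrightarrow> t \<le> p" and "0 < j" "j < t"
  shows "coprime s j"
proof (rule ccontr)
  assume "\<not> coprime s j"
  then obtain p where p: "prime p" "p dvd s" "p dvd j"
    by (metis coprime_iff_gcd_eq_1 gcd_dvd1 gcd_dvd2 dvd_trans prime_factor_nat)
  have "p \<le> j" using p(3) assms(2) by (rule dvd_imp_le)
  with assms(1)[OF p(1,2)] assms(3) show False by linarith
qed

context cring
begin

definition binomial_term :: "'a \<Rightarrow> 'a \<Rightarrow> nat \<Rightarrow> nat \<Rightarrow> 'a" where
  "binomial_term x y n i = [(n choose i)] \<cdot> (x [^] (n - i) \<otimes> y [^] i)"

lemma binomial_term_closed [simp, intro]:
  "x \<in> carrier R \<Longrightarrow> y \<in> carrier R \<Longrightarrow> binomial_term x y n i \<in> carrier R"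
  by (simp add: binomial_term_def)

lemma binomial_term_0:
  "x \<in> carrier R \<Longrightarrow> y \<in> carrier R \<Longrightarrow> binomial_term x y n 0 = x [^] n"
  by (simp add: binomial_term_def)

lemma binomial_term_Suc_0:
  "x \<in> carrier R \<Longrightarrow> y \<in> carrier R \<Longrightarrow> binomial_term x y (Suc n) 0 = x \<otimes> binomial_term x y n 0"
  by (simp add: binomial_term_0 m_comm)

lemma binomial_term_Suc_Suc:
  assumes [simp]: "x \<in> carrier R" "y \<in> carrier R"
  shows "binomial_term x y (Suc n) (Suc i)
       = x \<otimes> binomial_term x y n (Suc i) \<oplus> y \<otimes> binomial_term x y n i"
proof -
  have 1: "[(n choose Suc i)] \<cdot> (x [^] (n - i) \<otimes> y [^] Suc i) = x \<otimes> binomial_term x y n (Suc i)"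
  proof (cases "i < n")
    case True
    then obtain r where n: "n = i + Suc r" using less_imp_Suc_add by auto
    have "x [^] (n - i) \<otimes> y [^] Suc i = x \<otimes> (x [^] (n - Suc i) \<otimes> y [^] Suc i)"
      by (simp add: n m_ac)
    thus ?thesis by (simp add: binomial_term_def add_pow_rdistr del: nat_pow_Suc)
  next
    \<comment> \<open>Here the exponent \<open>n - Suc i\<close> is truncated, but the coefficient vanishes.\<close>
    case False
    thus ?thesis by (simp add: binomial_term_def binomial_eq_0)
  qed
  have "x [^] (n - i) \<otimes> y [^] Suc i = y \<otimes> (x [^] (n - i) \<otimes> y [^] i)"
    by (simp add: m_ac)
  hence 2: "[(n choose i)] \<cdot> (x [^] (n - i) \<otimes> y [^] Suc i) = y \<otimes> binomial_term x y n i"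
    by (simp add: binomial_term_def add_pow_rdistr del: nat_pow_Suc)
  have "binomial_term x y (Suc n) (Suc i)
      = [(n choose i)] \<cdot> (x [^] (n - i) \<otimes> y [^] Suc i)
        \<oplus> [(n choose Suc i)] \<cdot> (x [^] (n - i) \<otimes> y [^] Suc i)"
    by (simp add: binomial_term_def add.nat_pow_mult del: nat_pow_Suc)
  thus ?thesis unfolding 1 2 by (simp add: a_comm)
qed

lemma binomial_theorem:
  assumes [simp]: "x \<in> carrier R" "y \<in> carrier R"
  shows "(x \<oplus> y) [^] (n::nat) = (\<Oplus>i\<in>{..n}. binomial_term x y n i)"
proof (induction n)
  case 0
  show ?case by (simp add: binomial_term_def)
next
  case (Suc n)
  let ?T = "binomial_term x y"
  have split_top: "(\<Oplus>i\<in>{..Suc n}. ?T n i) = (\<Oplus>i\<in>{..n}. ?T n i)"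
  proof -
    have "?T n (Suc n) = \<zero>" by (simp add: binomial_term_def binomial_eq_0)
    thus ?thesis by (simp add: Pi_def)
  qed
  have split_bot: "(\<Oplus>i\<in>{..Suc n}. ?T m i) = (\<Oplus>i\<in>{..n}. ?T m (Suc i)) \<oplus> ?T m 0" for m
    by (rule finsum_Suc2) simp
  have "(\<Oplus>i\<in>{..Suc n}. ?T (Suc n) i)
      = (\<Oplus>i\<in>{..n}. x \<otimes> ?T n (Suc i) \<oplus> y \<otimes> ?T n i) \<oplus> x \<otimes> ?T n 0"
    by (simp only: split_bot binomial_term_Suc_Suc binomial_term_Suc_0 assms)
  also have "\<dots> = (x \<otimes> (\<Oplus>i\<in>{..n}. ?T n (Suc i)) \<oplus> y \<otimes> (\<Oplus>i\<in>{..n}. ?T n i)) \<oplus> x \<otimes> ?T n 0"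
    by (simp add: finsum_addf finsum_rdistr Pi_def)
  also have "\<dots> = x \<otimes> ((\<Oplus>i\<in>{..n}. ?T n (Suc i)) \<oplus> ?T n 0) \<oplus> y \<otimes> (\<Oplus>i\<in>{..n}. ?T n i)"
    by (simp add: r_distr a_ac Pi_def)
  also have "\<dots> = x \<otimes> (\<Oplus>i\<in>{..n}. ?T n i) \<oplus> y \<otimes> (\<Oplus>i\<in>{..n}. ?T n i)"
    by (simp only: split_bot[symmetric] split_top)
  also have "\<dots> = (x \<oplus> y) [^] Suc n"
    by (simp add: Suc.IH[symmetric] l_distr r_distr m_ac)
  finally show ?case by simp
qed

lemma finsum_in_ideal:
  assumes J: "ideal J R" and "\<And>i. i \<in> A \<Longrightarrow> f i \<in> J"
  shows "finsum R f A \<in> J"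
  using assms(2)
proof (induction A rule: infinite_finite_induct)
  interpret J: ideal J R by (rule J)
  case (infinite A)
  thus ?case by (simp add: finsum_infinite J.zero_closed)
next
  interpret J: ideal J R by (rule J)
  case empty
  thus ?case by (simp add: J.zero_closed)
next
  interpret J: ideal J R by (rule J)
  case (insert a A)
  have "f \<in> A \<rightarrow> carrier R" "f a \<in> carrier R" using insert.prems J.Icarr by auto
  with insert show ?case by (simp add: finsum_insert J.a_closed)
qed

section \<open>One link of the chain\<close>

lemma pow_in_if_ideal_pow_subset:
  assumes I: "ideal I R" and J: "ideal J R" and sub: "ideal_pow R I t \<subseteq> J"
    and d: "d \<in> I" and "t \<le> n"
  shows "d [^] n \<in> J"
proof -
  interpret I: ideal I R by (rule I)
  interpret J: ideal J R by (rule J)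
  have dR: "d \<in> carrier R" using d by (rule I.Icarr)
  let ?P = "{finprod R x {1..t} | x. x \<in> {1..t} \<rightarrow> I}"
  have "?P \<subseteq> carrier R" using I.Icarr by (auto intro!: finprod_closed simp: Pi_iff)
  hence "?P \<subseteq> J" using genideal_self sub unfolding ideal_pow_def by blast
  moreover have "finprod R (\<lambda>_. d) {1..t} = d [^] t" using dR by (subst finprod_const) auto
  ultimately have "d [^] t \<in> J" using d by force
  moreover have "d [^] n = d [^] (n - t) \<otimes> d [^] t" using dR \<open>t \<le> n\<close> by (simp add: nat_pow_mult)
  ultimately show ?thesis using dR by (simp add: J.I_l_closed)
qed

lemma add_pow_in_ideal_if_dvd:
  assumes J: "ideal J R" and "s dvd c" "x \<in> carrier R" "[(s::nat)] \<cdot> x \<in> J"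
  shows "[c] \<cdot> x \<in> J"
proof -
  interpret J: ideal J R by (rule J)
  obtain m where c: "c = s * m" using \<open>s dvd c\<close> by (auto elim: dvdE)
  have "[c] \<cdot> x = [m] \<cdot> ([s] \<cdot> x)" using assms(3) by (simp add: c add.nat_pow_pow mult.commute)
  also have "\<dots> = ([m] \<cdot> \<one>) \<otimes> ([s] \<cdot> x)" using assms(3) by (simp add: add_pow_ldistr)
  also have "\<dots> \<in> J" using assms(4) by (simp add: J.I_l_closed)
  finally show ?thesis .
qed

text \<open>The bound on the prime factors of \<open>s\<close> makes \<open>s\<close> divide \<open>s choose j\<close>
  for \<open>0 < j < t\<close>, so those terms of the expansion lie in \<open>s I \<subseteq> J\<close>; for \<open>j \<ge> t\<close> the factor
  \<open>d\<^sup>j\<close> is in \<open>J\<close>.\<close>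

lemma pow_add_cong_pow_mod_ideal:
  assumes I: "ideal I R" and J: "ideal J R" and sub: "ideal_pow R I t \<subseteq> J"
    and "1 \<le> s" and sI: "\<And>x. x \<in> I \<Longrightarrow> [s] \<cdot> x \<in> J"
    and primes: "\<And>p. prime p \<Longrightarrow> p dvd s \<Longrightarrow> t \<le> p"
    and f: "f \<in> carrier R" and d: "d \<in> I"
  shows "(f \<oplus> d) [^] s \<ominus> f [^] s \<in> J"
proof -
  interpret I: ideal I R by (rule I)
  interpret J: ideal J R by (rule J)
  have dR: "d \<in> carrier R" using d by (rule I.Icarr)
  obtain r where r: "s = Suc r" using \<open>1 \<le> s\<close> by (cases s) auto
  let ?T = "binomial_term f d s"
  have T: "?T j \<in> J" if "0 < j" for j
  proof (cases "j < t")
    case True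
    have "s dvd (s choose j)"
      using coprime_if_prime_factors_ge[OF primes that True] that by (rule dvd_binomial_if_coprime)
    moreover have "d [^] j = d [^] (j - 1) \<otimes> d"
      using dR that by (cases j) auto
    hence "d [^] j \<in> I" using d dR by (simp add: I.I_l_closed)
    hence "[s] \<cdot> (f [^] (s - j) \<otimes> d [^] j) \<in> J" using f by (intro sI I.I_l_closed) auto
    ultimately show ?thesis unfolding binomial_term_def
      using f dR by (blast intro: add_pow_in_ideal_if_dvd[OF J])
  next
    case False
    have "d [^] j \<in> J" using pow_in_if_ideal_pow_subset[OF I J sub d] False by simp
    hence in_J: "f [^] (s - j) \<otimes> d [^] j \<in> J" using f by (simp add: J.I_l_closed)
    \<comment> \<open>Every multiple of an element of \<open>J\<close> is in \<open>J\<close>: the case \<open>s = 1\<close> of the lemma.\<close>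
    show ?thesis unfolding binomial_term_def
      by (rule add_pow_in_ideal_if_dvd[OF J, of 1]) (use in_J f dR in auto)
  qed
  let ?S = "\<Oplus>j\<in>{..r}. ?T (Suc j)"
  have S: "?S \<in> J" by (rule finsum_in_ideal[OF J]) (simp add: T)
  have SR: "?S \<in> carrier R" using S by (rule J.Icarr)
  have "(f \<oplus> d) [^] s = (\<Oplus>j\<in>{..Suc r}. ?T j)"
    using binomial_theorem[OF f dR, of s] r by simp
  also have "\<dots> = ?S \<oplus> ?T 0" by (rule finsum_Suc2) (use f dR in auto)
  also have "?T 0 = f [^] s" using f dR by (rule binomial_term_0)
  finally have "(f \<oplus> d) [^] s \<ominus> f [^] s = ?S"
    using SR f by (simp add: minus_eq a_assoc r_neg)
  thus ?thesis using S by simp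
qed

lemma idempotent_mod_ideal_pow:
  assumes "ideal I R" "ideal J R" "ideal_pow R I t \<subseteq> J"
    and "1 \<le> s" and "\<And>x. x \<in> I \<Longrightarrow> [s] \<cdot> x \<in> J"
    and "\<And>p. prime p \<Longrightarrow> p dvd s \<Longrightarrow> t \<le> p"
    and f: "f \<in> carrier R" and d: "f [^] (2::nat) \<ominus> f \<in> I"
  shows "(f [^] s) [^] (2::nat) \<ominus> f [^] s \<in> J"
proof -
  have "f \<oplus> (f [^] (2::nat) \<ominus> f) = f [^] (2::nat)"
    using f unfolding minus_eq by (subst a_lcomm) (auto simp: r_neg)
  hence "(f \<oplus> (f [^] (2::nat) \<ominus> f)) [^] s = (f [^] s) [^] (2::nat)"
    using f by (simp add: nat_pow_pow mult.commute)
  thus ?thesis using pow_add_cong_pow_mod_ideal[OF assms(1-6) f d] by simp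
qed

section \<open>Idempotents of a ring and of its quotients\<close>

lemma idempotents_pow_eq:
  assumes "e \<in> idempotents R" "0 < n"
  shows "e [^] (n::nat) = e"
  using assms(2)
proof (induction n rule: nat_induct_non_zero)
  case 1
  show ?case using assms(1) by (simp add: idempotents_def)
next
  case (Suc n)
  thus ?case using assms(1) by (auto simp: idempotents_def numeral_2_eq_2)
qed

lemma rcos_in_idempotents_Quot_iff:
  assumes I: "ideal I R" and f: "f \<in> carrier R"
  shows "I +> f \<in> idempotents (R Quot I) \<longleftrightarrow> f [^] (2::nat) \<ominus> f \<in> I"
proof -
  interpret h: ring_hom_ring R "R Quot I" "(+>) I" by (rule ideal.rcos_ring_hom_ring[OF I])
  have "I +> f \<in> idempotents (R Quot I) \<longleftrightarrow> I +> (f [^] (2::nat)) = I +> f"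
    using f h.hom_closed[OF f] by (simp add: idempotents_def h.hom_nat_pow[OF f])
  also have "\<dots> \<longleftrightarrow> f [^] (2::nat) \<ominus> f \<in> I"
    using f by (simp add: quotient_eq_iff_same_a_r_cos[OF I])
  finally show ?thesis .
qed

text \<open>In \<open>(e - e')\<^sup>3 = e - 3ee' + 3ee' - e'\<close> the mixed terms cancel. A square would not
  do: \<open>e - e'\<close> is in general not idempotent.\<close>

lemma idempotents_diff_cube:
  assumes "e \<in> idempotents R" "e' \<in> idempotents R"
  shows "(e \<ominus> e') [^] (3::nat) = e \<ominus> e'"
proof -
  have c [simp]: "e \<in> carrier R" "e' \<in> carrier R" using assms by (auto simp: idempotents_def)
  have sq: "e \<otimes> e = e" "e' \<otimes> e' = e'" using assms by (auto simp: idempotents_def numeral_2_eq_2)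
  have sq': "e \<otimes> (e \<otimes> z) = e \<otimes> z" "e' \<otimes> (e' \<otimes> z) = e' \<otimes> z" if "z \<in> carrier R" for z
    using that by (simp_all add: m_assoc[symmetric] sq)
  have "(e \<ominus> e') [^] (3::nat) = (e \<ominus> e') \<otimes> (e \<ominus> e') \<otimes> (e \<ominus> e')"
    by (simp add: numeral_3_eq_3)
  also have "\<dots> = e \<ominus> e'"
    by (simp add: minus_eq l_distr r_distr l_minus r_minus m_ac sq sq' minus_add a_ac r_neg r_neg1 r_neg2)
  finally show ?thesis .
qed

lemma odd_pow_eq_if_cube_eq:
  assumes [simp]: "d \<in> carrier R" and "d [^] (3::nat) = d"
  shows "d [^] (2 * n + 1 :: nat) = d"
proof (induction n)
  case (Suc n)
  have "d [^] (2 * Suc n + 1) = d [^] (2 * n + 1) \<otimes> d [^] (2::nat)"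
    by (subst nat_pow_mult) auto
  also have "\<dots> = d [^] (3::nat)"
    unfolding Suc.IH by (simp add: numeral_3_eq_3 numeral_2_eq_2 m_ac)
  finally show ?case using assms(2) by simp
qed simp

section \<open>Descending the chain\<close>

text \<open>The nilpotency index and the characteristic attain their defining minima, so a link of a
  CNC chain satisfies the hypotheses of the one-link lemmas with these very numbers.\<close>

lemma CNC_link:
  assumes "CNC R k N" "i \<in> {1..<k}"
  shows "ideal_pow R (N i) (nilpotency_index R (N i) (N (Suc i))) \<subseteq> N (Suc i)"
    and "characteristic_in R (N i) (N (Suc i)) (ideal_characteristic R (N i) (N (Suc i)))"
proof -
  have "\<exists>t. nilpotent_in R (N i) (N (Suc i)) t" "\<exists>s. characteristic_in R (N i) (N (Suc i)) s"
    using assms unfolding CNC_def by blast+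
  thus "ideal_pow R (N i) (nilpotency_index R (N i) (N (Suc i))) \<subseteq> N (Suc i)"
    and "characteristic_in R (N i) (N (Suc i)) (ideal_characteristic R (N i) (N (Suc i)))"
    unfolding nilpotency_index_def ideal_characteristic_def
    by (metis LeastI_ex nilpotent_in_def, metis LeastI_ex)
qed

lemma CNC_descend_idempotent:
  assumes cnc: "CNC R k N"
    and s: "\<And>i. i \<in> {1..<k} \<Longrightarrow> s i = ideal_characteristic R (N i) (N (Suc i))"
    and f: "f \<in> carrier R" and i: "1 \<le> i" and fi: "f [^] (2::nat) \<ominus> f \<in> N i"
    and "i \<le> j" "j \<le> k"
  shows "(f [^] (\<Prod>l\<in>{i..<j}. s l)) [^] (2::nat) \<ominus> f [^] (\<Prod>l\<in>{i..<j}. s l) \<in> N j"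
  using \<open>i \<le> j\<close> \<open>j \<le> k\<close>
proof (induction j rule: dec_induct)
  case base
  show ?case using fi f by simp
next
  case (step j)
  have j: "j \<in> {1..<k}" using step i by auto
  have ideals: "ideal (N j) R" "ideal (N (Suc j)) R" using cnc j unfolding CNC_def by auto
  let ?m = "\<Prod>l\<in>{i..<j}. s l"
  have char: "characteristic_in R (N j) (N (Suc j)) (s j)"
    using CNC_link(2)[OF cnc j] s[OF j] by simp
  have "(f [^] ?m) [^] (2::nat) \<ominus> f [^] ?m \<in> N j" using step by simp
  hence "((f [^] ?m) [^] s j) [^] (2::nat) \<ominus> (f [^] ?m) [^] s j \<in> N (Suc j)"
    using char f unfolding characteristic_in_def
    by (intro idempotent_mod_ideal_pow[OF ideals CNC_link(1)[OF cnc j]]) auto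
  moreover have "(f [^] ?m) [^] s j = f [^] (\<Prod>l\<in>{i..<Suc j}. s l)"
    using f step.hyps by (simp add: nat_pow_pow prod.atLeastLessThan_Suc)
  ultimately show ?case by simp
qed

lemma CNC_idempotent_pow:
  assumes cnc: "CNC R k N"
    and s: "\<And>i. i \<in> {1..<k} \<Longrightarrow> s i = ideal_characteristic R (N i) (N (Suc i))"
    and i: "i \<in> {1..k}" and f: "f \<in> carrier R" and idem: "N i +> f \<in> idempotents (R Quot N i)"
  shows "f [^] (\<Prod>l\<in>{i..<k}. s l) \<in> idempotents R"
proof -
  let ?g = "f [^] (\<Prod>l\<in>{i..<k}. s l)"
  have g: "?g \<in> carrier R" using f by simp
  have "ideal (N i) R" and Nk: "N k = {\<zero>}" using cnc i unfolding CNC_def by auto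
  hence "f [^] (2::nat) \<ominus> f \<in> N i" using idem f rcos_in_idempotents_Quot_iff by blast
  hence "?g [^] (2::nat) \<ominus> ?g \<in> N k"
    using i by (auto intro: CNC_descend_idempotent[where s = s, OF cnc s f])
  hence "?g [^] (2::nat) \<ominus> ?g = \<zero>" using Nk by simp
  hence "?g [^] (2::nat) = ?g" using g by simp
  thus ?thesis using g by (simp add: idempotents_def)
qed

text \<open>For \<open>d \<in> N\<^sub>j\<close> with \<open>d\<^sup>3 = d\<close>, the odd power \<open>d = d\<^bsup>2t+1\<^esup>\<close> is in \<open>N\<^sub>j\<^sup>t \<subseteq> N\<^bsub>j+1\<^esub>\<close>
  for the nilpotency index \<open>t\<close> of that link, so \<open>d\<close> sinks to the bottom of the chain.\<close>

lemma CNC_cube_eq_imp_zero: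
  assumes cnc: "CNC R k N" and i: "i \<in> {1..k}" and d: "d \<in> N i" and cube: "d [^] (3::nat) = d"
  shows "d = \<zero>"
proof -
  have dR: "d \<in> carrier R" using cnc i d unfolding CNC_def by (blast intro: ideal.Icarr)
  have "d \<in> N j" if "i \<le> j" "j \<le> k" for j
    using that
  proof (induction j rule: dec_induct)
    case base
    show ?case by (rule d)
  next
    case (step j)
    have j: "j \<in> {1..<k}" using step i by auto
    have ideals: "ideal (N j) R" "ideal (N (Suc j)) R" using cnc j unfolding CNC_def by auto
    let ?t = "nilpotency_index R (N j) (N (Suc j))"
    have "d [^] (2 * ?t + 1) \<in> N (Suc j)"
      using step by (intro pow_in_if_ideal_pow_subset[OF ideals CNC_link(1)[OF cnc j]]) auto
    thus ?case unfolding odd_pow_eq_if_cube_eq[OF dR cube] .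
  qed
  hence "d \<in> N k" using i by simp
  thus ?thesis using cnc unfolding CNC_def by simp
qed

lemma CNC_bij_betw_idempotents:
  assumes cnc: "CNC R k N" and i: "i \<in> {1..k}"
  shows "bij_betw ((+>) (N i)) (idempotents R) (idempotents (R Quot N i))"
proof -
  have I: "ideal (N i) R" using cnc i unfolding CNC_def by blast
  interpret h: ring_hom_ring R "R Quot N i" "(+>) (N i)" by (rule ideal.rcos_ring_hom_ring[OF I])
  interpret Q: cring "R Quot N i" by (rule ideal.quotient_is_cring[OF I is_cring])
  show ?thesis
  proof (rule bij_betw_imageI)
    show "inj_on ((+>) (N i)) (idempotents R)"
    proof (rule inj_onI)
      fix e e' assume e: "e \<in> idempotents R" "e' \<in> idempotents R" and eq: "N i +> e = N i +> e'"
      have c: "e \<in> carrier R" "e' \<in> carrier R" using e by (auto simp: idempotents_def)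
      have "e \<ominus> e' \<in> N i" using eq quotient_eq_iff_same_a_r_cos[OF I c] by simp
      hence "e \<ominus> e' = \<zero>" using idempotents_diff_cube[OF e] by (rule CNC_cube_eq_imp_zero[OF cnc i])
      thus "e = e'" using c by simp
    qed
    show "(+>) (N i) ` idempotents R = idempotents (R Quot N i)"
    proof (intro subset_antisym subsetI)
      fix y assume "y \<in> (+>) (N i) ` idempotents R"
      then obtain e where e: "e \<in> idempotents R" "y = N i +> e" by blast
      hence "e \<in> carrier R" "e [^] (2::nat) \<ominus> e = \<zero>" by (auto simp: idempotents_def)
      thus "y \<in> idempotents (R Quot N i)"
        using rcos_in_idempotents_Quot_iff[OF I] e(2)
          additive_subgroup.zero_closed[OF ideal.axioms(1)[OF I]] by metis
    next
      fix y assume y: "y \<in> idempotents (R Quot N i)"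
      then obtain f where f: "f \<in> carrier R" "y = N i +> f"
        unfolding idempotents_def FactRing_def A_RCOSETS_def' by auto
      let ?m = "\<Prod>l\<in>{i..<k}. ideal_characteristic R (N l) (N (Suc l))"
      have "f [^] ?m \<in> idempotents R"
        using CNC_idempotent_pow[OF cnc _ i f(1)] y f(2) by simp
      moreover have "0 < ideal_characteristic R (N l) (N (Suc l))" if "l \<in> {i..<k}" for l
        using CNC_link(2)[OF cnc, of l] i that by (simp add: characteristic_in_def)
      hence "0 < ?m" by (simp add: prod_pos)
      hence "N i +> (f [^] ?m) = y"
        using f Q.idempotents_pow_eq[OF y] by (simp add: h.hom_nat_pow)
      ultimately show "y \<in> (+>) (N i) ` idempotents R" by blast
    qed
  qed
qed

end

section \<open>Lifting idempotents along a CNC chain\<close>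

theorem theorem3p3:
  fixes R :: "('a, 'b) ring_scheme"
    and N :: "nat \<Rightarrow> 'a set"
    and k :: nat
    and s :: "nat \<Rightarrow> nat"
  assumes "cring R"
    and "CNC R k N"
    and "\<And>i. i \<in> {1..<k} \<Longrightarrow> s i = ideal_characteristic R (N i) (N (Suc i))"
  shows "(\<forall>f\<in>carrier R. N 1 +>\<^bsub>R\<^esub> f \<in> idempotents (R Quot N 1) \<longrightarrow>
           f [^]\<^bsub>R\<^esub> (\<Prod>i\<in>{1..<k}. s i) \<in> idempotents R) \<and>
         (\<forall>i\<in>{1..k}. idempotents R \<approx> idempotents (R Quot N i))"
proof (intro conjI ballI impI)
  fix f assume "f \<in> carrier R" "N 1 +>\<^bsub>R\<^esub> f \<in> idempotents (R Quot N 1)"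
  moreover have "1 \<in> {1..k}" using assms(2) by (simp add: CNC_def)
  ultimately show "f [^]\<^bsub>R\<^esub> (\<Prod>i\<in>{1..<k}. s i) \<in> idempotents R"
    by (intro cring.CNC_idempotent_pow[where s = s and i = 1, OF assms])
next
  fix i assume "i \<in> {1..k}"
  thus "idempotents R \<approx> idempotents (R Quot N i)"
    using cring.CNC_bij_betw_idempotents[OF assms(1,2)] unfolding eqpoll_def by blast
qed

end
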